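(* There is a signed almost periodic multiple discrete set $A$ (in $\mathbb{R}^p$ for some $p\ge1$) such that $A^+$ and $A^-$ are both not almost periodic.
   Context: A continuous function $f$ on $\mathbb{R}^p$ is almost periodic if for every $\varepsilon>0$ the set $\{\tau\in\mathbb{R}^p:\sup_{x\in\mathbb{R}^p}|f(x+\tau)-f(x)|<\varepsilon\}$ is relatively dense in $\mathbb{R}^p$, i.e. there is $R=R(\varepsilon)<\infty$ such that every ball of radius $R$ contains an element of this set. A locally finite signed Borel measure $\mu$ on $\mathbb{R}^p$ is almost periodic (in the weak sense) if for every continuous compactly supported function $\varphi$ on $\mathbb{R}^p$ the function $x\mapsto\int\varphi(x+t)\,d\mu(t)$ is almost periodic on $\mathbb{R}^p$. A signed multiple discrete set $A=\{(x,m(x))\}$ in $\mathbb{R}^p$ is a discrete (locally finite) set $s(A)\subset\mathbb{R}^p$ together with a number $m(x)\in\mathbb{Z}\setminus\{0\}$ for each $x\in s(A)$. Its associated measure is $\mu_A=\sum_{x\in s(A)}m(x)\delta_x$, where $\delta_x$ is the unit mass at $x$. $A$ is called almost periodic if $\mu_A$ is almost periodic in the weak sense. Put $$A^+=\{(x,m(x)):x\in s(A),\,m(x)>0\},\qquad A^-=\{(x,m(x)):x\in s(A),\,m(x)<0\};$$ these are themselves signed multiple discrete sets. *)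

theory Defs
  imports "HOL-Analysis.Analysis" "HOL-Library.Function_Algebras"
begin

text \<open>
  The dimension \<open>p\<close> is existentially quantified in the theorem, so \<open>\<real>\<^sup>p\<close> is the carrier of
  the library topology \<^const>\<open>Euclidean_space\<close>: the functions \<open>nat \<Rightarrow> real\<close> vanishing at all
  indices \<open>\<ge> p\<close>. Addition is the pointwise one of \<open>Function_Algebras\<close>. Values of a function
  \<open>(nat \<Rightarrow> real) \<Rightarrow> real\<close> outside this carrier are irrelevant everywhere below.
\<close>

abbreviation Rp :: "nat \<Rightarrow> (nat \<Rightarrow> real) set" where
  "Rp p \<equiv> topspace (Euclidean_space p)"

definition Rp_ball :: "nat \<Rightarrow> (nat \<Rightarrow> real) \<Rightarrow> real \<Rightarrow> (nat \<Rightarrow> real) set" where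
  "Rp_ball p c r = {y \<in> Rp p. L2_set (\<lambda>i. y i - c i) {..<p} < r}"

definition Rp_borel :: "nat \<Rightarrow> (nat \<Rightarrow> real) measure" where
  "Rp_borel p = sigma (Rp p) {U. openin (Euclidean_space p) U}"


subsection \<open>Almost periodic functions\<close>

definition relatively_dense :: "nat \<Rightarrow> (nat \<Rightarrow> real) set \<Rightarrow> bool" where
  "relatively_dense p T \<longleftrightarrow> (\<exists>R::real. \<forall>c\<in>Rp p. T \<inter> Rp_ball p c R \<noteq> {})"

text \<open>The supremum is taken in \<^typ>\<open>ereal\<close>, so that it is \<open>\<infinity>\<close> for unbounded differences.\<close>

definition almost_periodic_fun :: "nat \<Rightarrow> ((nat \<Rightarrow> real) \<Rightarrow> real) \<Rightarrow> bool" where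
  "almost_periodic_fun p f \<longleftrightarrow>
     continuous_map (Euclidean_space p) euclideanreal f \<and>
     (\<forall>\<epsilon>::real. \<epsilon> > 0 \<longrightarrow>
        relatively_dense p
          {\<tau> \<in> Rp p. (SUP x\<in>Rp p. ereal \<bar>f (x + \<tau>) - f x\<bar>) < ereal \<epsilon>})"


subsection \<open>Almost periodic signed measures\<close>

text \<open>
  A locally finite signed measure on \<open>\<real>\<^sup>p\<close> is in general not a function on all Borel sets, since
  \<open>\<infinity> - \<infinity>\<close> may occur on unbounded ones. It is represented by a pair \<open>(M, N)\<close> of locally finite
  positive Borel measures, standing for \<open>M - N\<close>. All notions below depend on the
  difference only.
\<close>

type_synonym signed_measure = "(nat \<Rightarrow> real) measure \<times> (nat \<Rightarrow> real) measure"

definition locally_finite_measure :: "nat \<Rightarrow> (nat \<Rightarrow> real) measure \<Rightarrow> bool" where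
  "locally_finite_measure p M \<longleftrightarrow>
     space M = Rp p \<and> sets M = sets (Rp_borel p) \<and>
     (\<forall>c\<in>Rp p. \<forall>r. emeasure M (Rp_ball p c r) < \<infinity>)"

definition locally_finite_signed_measure :: "nat \<Rightarrow> signed_measure \<Rightarrow> bool" where
  "locally_finite_signed_measure p \<mu> \<longleftrightarrow>
     locally_finite_measure p (fst \<mu>) \<and> locally_finite_measure p (snd \<mu>)"

definition signed_integral :: "signed_measure \<Rightarrow> ((nat \<Rightarrow> real) \<Rightarrow> real) \<Rightarrow> real" where
  "signed_integral \<mu> f = (\<integral>t. f t \<partial>fst \<mu>) - (\<integral>t. f t \<partial>snd \<mu>)"

definition continuous_compact_support :: "nat \<Rightarrow> ((nat \<Rightarrow> real) \<Rightarrow> real) \<Rightarrow> bool" where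
  "continuous_compact_support p \<phi> \<longleftrightarrow>
     continuous_map (Euclidean_space p) euclideanreal \<phi> \<and>
     compactin (Euclidean_space p) (Euclidean_space p closure_of {x \<in> Rp p. \<phi> x \<noteq> 0})"

definition almost_periodic_measure :: "nat \<Rightarrow> signed_measure \<Rightarrow> bool" where
  "almost_periodic_measure p \<mu> \<longleftrightarrow>
     locally_finite_signed_measure p \<mu> \<and>
     (\<forall>\<phi>. continuous_compact_support p \<phi> \<longrightarrow>
        almost_periodic_fun p (\<lambda>x. signed_integral \<mu> (\<lambda>t. \<phi> (x + t))))"


subsection \<open>Signed multiple discrete sets\<close>

type_synonym multiple_set = "((nat \<Rightarrow> real) \<times> int) set"

definition signed_multiple_discrete_set :: "nat \<Rightarrow> multiple_set \<Rightarrow> bool" where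
  "signed_multiple_discrete_set p A \<longleftrightarrow>
     single_valued A \<and> fst ` A \<subseteq> Rp p \<and> (\<forall>(x, k)\<in>A. k \<noteq> 0) \<and>
     (\<forall>c\<in>Rp p. \<forall>r. finite (fst ` A \<inter> Rp_ball p c r))"

text \<open>
  For a weight \<open>w\<close>, the measure below is \<open>\<Sum>(x, k)\<in>A. w k \<cdot> \<delta>\<^sub>x\<close> (negative weights count as \<open>0\<close>);
  splitting the multiplicities by sign gives the signed measure \<open>\<Sum>(x, k)\<in>A. k \<cdot> \<delta>\<^sub>x\<close>.
\<close>

definition weighted_point_masses :: "nat \<Rightarrow> (int \<Rightarrow> int) \<Rightarrow> multiple_set \<Rightarrow> (nat \<Rightarrow> real) measure" where
  "weighted_point_masses p w A =
     distr (density (count_space A) (\<lambda>(x, k). ennreal (real_of_int (w k)))) (Rp_borel p) fst"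

definition associated_measure :: "nat \<Rightarrow> multiple_set \<Rightarrow> signed_measure" where
  "associated_measure p A =
     (weighted_point_masses p (\<lambda>k. k) A, weighted_point_masses p (\<lambda>k. - k) A)"

definition almost_periodic_set :: "nat \<Rightarrow> multiple_set \<Rightarrow> bool" where
  "almost_periodic_set p A \<longleftrightarrow> almost_periodic_measure p (associated_measure p A)"

definition positive_part :: "multiple_set \<Rightarrow> multiple_set" where
  "positive_part A = {(x, k). (x, k) \<in> A \<and> k > 0}"

definition negative_part :: "multiple_set \<Rightarrow> multiple_set" where
  "negative_part A = {(x, k). (x, k) \<in> A \<and> k < 0}"


subsection \<open>Well-definedness\<close>

lemma signed_multiple_discrete_set_subset:
  assumes "signed_multiple_discrete_set p A" "B \<subseteq> A"
  shows "signed_multiple_discrete_set p B"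
proof -
  have "fst ` B \<subseteq> fst ` A"
    using assms(2) by (rule image_mono)
  moreover have "finite (fst ` B \<inter> Rp_ball p c r)" if "c \<in> Rp p" for c r
  proof (rule finite_subset)
    show "fst ` B \<inter> Rp_ball p c r \<subseteq> fst ` A \<inter> Rp_ball p c r"
      using calculation by (rule Int_mono) (rule order_refl)
    show "finite (fst ` A \<inter> Rp_ball p c r)"
      using assms(1) that by (simp add: signed_multiple_discrete_set_def)
  qed
  moreover have "single_valued B"
    using assms by (auto simp: signed_multiple_discrete_set_def intro: single_valued_subset)
  moreover have "\<forall>(x, k)\<in>B. k \<noteq> 0"
    using assms by (auto simp: signed_multiple_discrete_set_def)
  ultimately show ?thesis
    using assms(1) unfolding signed_multiple_discrete_set_def by (meson order_trans)
qed

lemma signed_multiple_discrete_set_parts: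
  assumes "signed_multiple_discrete_set p A"
  shows "signed_multiple_discrete_set p (positive_part A)"
    and "signed_multiple_discrete_set p (negative_part A)"
  by (rule signed_multiple_discrete_set_subset[OF assms];
      auto simp: positive_part_def negative_part_def)+

lemma space_Rp_borel: "space (Rp_borel p) = Rp p"
  unfolding Rp_borel_def by (rule space_measure_of) (auto dest: openin_subset)

lemma emeasure_weighted_point_masses:
  assumes "fst ` A \<subseteq> Rp p" "B \<in> sets (Rp_borel p)"
  shows "emeasure (weighted_point_masses p w A) B =
           (\<integral>\<^sup>+(x, k). ennreal (real_of_int (w k)) * indicator B x \<partial>count_space A)"
proof -
  let ?D = "density (count_space A) (\<lambda>(x, k). ennreal (real_of_int (w k)))"
  have "fst \<in> measurable ?D (Rp_borel p)"
    using assms(1) by (auto simp: measurable_def space_Rp_borel)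
  then have "emeasure (weighted_point_masses p w A) B = emeasure ?D (fst -` B \<inter> A)"
    unfolding weighted_point_masses_def using assms(2) by (simp add: emeasure_distr)
  also have "\<dots> = (\<integral>\<^sup>+z. (\<lambda>(x, k). ennreal (real_of_int (w k))) z *
                        indicator (fst -` B \<inter> A) z \<partial>count_space A)"
    by (rule emeasure_density) auto
  also have "\<dots> = (\<integral>\<^sup>+(x, k). ennreal (real_of_int (w k)) * indicator B x \<partial>count_space A)"
    by (rule nn_integral_cong) (auto simp: indicator_def split: prod.splits)
  finally show ?thesis .
qed

text \<open>
  The associated measure is always locally finite, so this conjunct of
  \<^const>\<open>almost_periodic_measure\<close> never decides whether a discrete set is almost periodic.
\<close>

lemma locally_finite_associated_measure:
  assumes A: "signed_multiple_discrete_set p A"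
  shows "locally_finite_signed_measure p (associated_measure p A)"
proof -
  have "emeasure (weighted_point_masses p w A) (Rp_ball p c r) < \<infinity>"
    if c: "c \<in> Rp p" for w c r
  proof (cases "Rp_ball p c r \<in> sets (Rp_borel p)")
    case True
    let ?B = "Rp_ball p c r"
    let ?F = "{z \<in> A. fst z \<in> ?B}"
    have "inj_on fst ?F"
    proof (rule inj_onI)
      fix y z assume "y \<in> ?F" "z \<in> ?F" "fst y = fst z"
      moreover have "single_valued A"
        using A by (simp add: signed_multiple_discrete_set_def)
      ultimately show "y = z"
        by (cases y; cases z) (auto dest: single_valuedD)
    qed
    moreover have "finite (fst ` A \<inter> ?B)"
      using A c unfolding signed_multiple_discrete_set_def by blast
    then have "finite (fst ` ?F)"
      by (rule rev_finite_subset) auto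
    ultimately have fin: "finite ?F"
      using finite_imageD by blast
    have "emeasure (weighted_point_masses p w A) ?B =
            (\<integral>\<^sup>+(x, k). ennreal (real_of_int (w k)) * indicator ?B x \<partial>count_space A)"
      using A True unfolding signed_multiple_discrete_set_def
      by (intro emeasure_weighted_point_masses) auto
    also have "\<dots> = (\<Sum>(x, k)\<in>?F. ennreal (real_of_int (w k)) * indicator ?B x)"
      by (rule nn_integral_count_space'[OF fin]) (auto simp: indicator_def)
    also have "\<dots> < \<infinity>"
      using fin by (auto simp: indicator_def ennreal_mult_less_top)
    finally show ?thesis .
  next
    case False
    then show ?thesis
      by (simp add: weighted_point_masses_def emeasure_notin_sets)
  qed
  moreover have "space (weighted_point_masses p w A) = Rp p"
    "sets (weighted_point_masses p w A) = sets (Rp_borel p)" for w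
    by (simp_all add: weighted_point_masses_def space_Rp_borel)
  ultimately have "locally_finite_measure p (weighted_point_masses p w A)" for w
    unfolding locally_finite_measure_def by blast
  then show ?thesis
    by (simp add: locally_finite_signed_measure_def associated_measure_def)
qed

end

theory Submission
  imports Defs "HOL-Library.Groups_Big_Fun"
begin

text \<open>
  Attach to every nonzero integer \<open>n\<close> a dipole \<open>\<delta>\<^bsub>n + h n\<^esub> - \<delta>\<^bsub>n\<^esub>\<close> on the real line, whose
  length \<open>h n\<close> is a positive number decreasing to \<open>0\<close> with the 2-adic valuation of \<open>n\<close>.
  Setting \<open>h 0 = 0\<close> makes \<open>h\<close> an almost periodic function on the integers (\<open>2\<^sup>K\<close> is an almost
  period), and the missing dipole at \<open>0\<close> is the empty one, so the whole configuration is almost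
  periodic. Each of its two parts is a small perturbation of the integers without \<open>0\<close>. An almost
  period \<open>\<tau> > 2\<close> would have to be close to an integer, and translation by \<open>\<tau>\<close> would then move a
  point of the set close to the hole at \<open>0\<close>.
\<close>

subsection \<open>The real line as \<open>Rp 1\<close>\<close>

definition line_point :: "real \<Rightarrow> nat \<Rightarrow> real" where
  "line_point r = (\<lambda>i. if i = 0 then r else 0)"

lemma line_point_0 [simp]: "line_point r 0 = r"
  by (simp add: line_point_def)

lemma line_point_eq_iff [simp]: "line_point r = line_point s \<longleftrightarrow> r = s"
  by (auto simp: line_point_def fun_eq_iff)

lemma line_point_add: "line_point r + line_point s = line_point (r + s)"
  by (auto simp: line_point_def fun_eq_iff)

lemma Rp_1_eq: "Rp 1 = range line_point"
proof -
  have "x = line_point (x 0)" if "\<forall>i\<ge>1. x i = 0" for x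
    using that by (auto simp: line_point_def fun_eq_iff Suc_le_eq)
  then show ?thesis
    by (auto simp: topspace_Euclidean_space line_point_def)
qed

lemma line_point_in [simp]: "line_point r \<in> Rp 1"
  by (simp add: Rp_1_eq del: One_nat_def)

lemma line_point_of: "x \<in> Rp 1 \<Longrightarrow> line_point (x 0) = x"
  by (auto simp: Rp_1_eq simp del: One_nat_def)

lemma line_point_in_ball: "line_point s \<in> Rp_ball 1 (line_point r) R \<longleftrightarrow> \<bar>s - r\<bar> < R"
  using line_point_in[of s] by (simp add: Rp_ball_def L2_set_def)

lemma continuous_map_line_point: "continuous_map euclideanreal (Euclidean_space 1) line_point"
proof -
  have "continuous_map euclideanreal (Euclidean_space 1) (\<lambda>x i. if i < 1 then x else 0)"
    by (subst continuous_map_componentwise_Euclidean_space) auto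
  then show ?thesis
    by (simp add: line_point_def[abs_def])
qed

lemma continuous_map_coordinate:
  "continuous_map (Euclidean_space p) euclideanreal (\<lambda>x. x i)"
  unfolding Euclidean_space_def
  by (rule continuous_map_from_subtopology) (metis UNIV_I continuous_map_product_coordinates)

text \<open>\<open>line_point\<close> is a homeomorphism from the real line onto
  \<open>Rp 1\<close>, with the coordinate at index \<open>0\<close> as its inverse. Continuity
  questions thus move to functions of one real variable.\<close>

lemma continuous_map_line_iff:
  "continuous_map (Euclidean_space 1) euclideanreal f \<longleftrightarrow>
     continuous_on UNIV (\<lambda>r. f (line_point r))"
proof
  assume "continuous_map (Euclidean_space 1) euclideanreal f"
  from continuous_map_compose[OF continuous_map_line_point this]
  show "continuous_on UNIV (\<lambda>r. f (line_point r))"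
    by (simp add: o_def)
next
  assume "continuous_on UNIV (\<lambda>r. f (line_point r))"
  then have "continuous_map euclideanreal euclideanreal (\<lambda>r. f (line_point r))"
    by simp
  \<comment> \<open>This composite agrees with \<open>f\<close> only on the carrier, which is all
    that \<open>continuous_map\<close> looks at.\<close>
  from continuous_map_compose[OF continuous_map_coordinate[of 1 0] this]
  show "continuous_map (Euclidean_space 1) euclideanreal f"
    by (rule continuous_map_eq) (simp add: line_point_of del: One_nat_def)
qed

lemma continuous_map_translate:
  assumes "continuous_map (Euclidean_space 1) euclideanreal \<phi>"
  shows "continuous_map (Euclidean_space 1) euclideanreal (\<lambda>t. \<phi> (line_point r + t))"
proof -
  have "continuous_on UNIV (\<lambda>s. \<phi> (line_point s))"
    using assms by (simp only: continuous_map_line_iff)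
  then have "continuous_on UNIV (\<lambda>s. \<phi> (line_point (r + s)))"
    by (rule continuous_on_compose2) (auto intro!: continuous_intros)
  then show ?thesis
    by (simp only: continuous_map_line_iff line_point_add)
qed

text \<open>The coordinate map sends the compact support to a compact, hence bounded, set of
  reals.\<close>

lemma continuous_compact_support_line:
  assumes "continuous_compact_support 1 \<phi>"
  obtains B where "B \<ge> 0" "\<And>r. \<bar>r\<bar> > B \<Longrightarrow> \<phi> (line_point r) = 0"
proof -
  let ?S = "{x \<in> Rp 1. \<phi> x \<noteq> 0}"
  have "compactin euclideanreal ((\<lambda>x. x 0) ` (Euclidean_space 1 closure_of ?S))"
    using assms continuous_map_coordinate image_compactin
    unfolding continuous_compact_support_def by blast
  then have "bounded ((\<lambda>x. x 0) ` (Euclidean_space 1 closure_of ?S))"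
    by (simp add: compact_imp_bounded)
  then obtain B where B: "B > 0" "\<And>x. x \<in> Euclidean_space 1 closure_of ?S \<Longrightarrow> \<bar>x 0\<bar> \<le> B"
    unfolding bounded_pos by auto
  have "\<phi> (line_point r) = 0" if "\<bar>r\<bar> > B" for r
  proof (rule ccontr)
    assume "\<phi> (line_point r) \<noteq> 0"
    then have "line_point r \<in> ?S"
      using line_point_in by blast
    then have "line_point r \<in> Euclidean_space 1 closure_of ?S"
      using closure_of_subset[of ?S "Euclidean_space 1"] by blast
    from B(2)[OF this] that show False
      by simp
  qed
  with B(1) show thesis
    using that by (meson less_imp_le)
qed


subsection \<open>Integration against the associated measure\<close>

lemma continuous_map_borel_measurable:
  assumes "continuous_map (Euclidean_space p) euclideanreal f"
  shows "f \<in> borel_measurable (Rp_borel p)"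
proof (rule borel_measurableI)
  fix S :: "real set"
  assume "open S"
  then have "openin (Euclidean_space p) {x \<in> Rp p. f x \<in> S}"
    using assms openin_continuous_map_preimage by fastforce
  moreover have "f -` S \<inter> space (Rp_borel p) = {x \<in> Rp p. f x \<in> S}"
    by (auto simp: space_Rp_borel)
  moreover have "{U. openin (Euclidean_space p) U} \<subseteq> Pow (Rp p)"
    by (auto dest: openin_subset)
  ultimately show "f -` S \<inter> space (Rp_borel p) \<in> sets (Rp_borel p)"
    unfolding Rp_borel_def by (auto intro: sigma_sets.Basic)
qed

text \<open>Only the finitely many atoms in \<open>J\<close> can contribute, so the integral is a
  finite sum. The factor \<open>max 0\<close> reflects that \<open>ennreal\<close> truncates
  negative weights to 0.\<close>

lemma integral_weighted_point_masses:
  assumes A: "fst ` A \<subseteq> Rp p" and f: "f \<in> borel_measurable (Rp_borel p)"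
    and J: "finite J" "J \<subseteq> A" "\<And>x k. (x, k) \<in> A - J \<Longrightarrow> f x = 0"
  shows "(\<integral>t. f t \<partial>weighted_point_masses p w A) =
           (\<Sum>(x, k)\<in>J. max 0 (real_of_int (w k)) * f x)"
proof -
  let ?g = "\<lambda>z::(nat \<Rightarrow> real) \<times> int. max 0 (real_of_int (w (snd z)))"
  have supp: "z \<in> J" if "z \<in> A" "f (fst z) \<noteq> 0" for z
    using J(3)[of "fst z" "snd z"] that by auto
  have eq: "(\<lambda>(x, k). ennreal (real_of_int (w k))) = (\<lambda>z. ennreal (?g z))"
    by (auto simp: fun_eq_iff max_def ennreal_neg)
  have "fst \<in> measurable (density (count_space A) (\<lambda>z. ennreal (?g z))) (Rp_borel p)"
    using A by (auto simp: measurable_def space_Rp_borel)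
  then have "(\<integral>t. f t \<partial>weighted_point_masses p w A) =
               (\<integral>z. f (fst z) \<partial>density (count_space A) (\<lambda>z. ennreal (?g z)))"
    unfolding weighted_point_masses_def eq using f by (rule integral_distr)
  also have "\<dots> = (\<integral>z. ?g z * f (fst z) \<partial>count_space A)"
    by (subst integral_density) auto
  also have "\<dots> = (\<Sum>z | z \<in> A \<and> ?g z * f (fst z) \<noteq> 0. ?g z * f (fst z))"
    using supp by (intro lebesgue_integral_count_space_finite_support finite_subset[OF _ J(1)]) auto
  also have "\<dots> = (\<Sum>z\<in>J. ?g z * f (fst z))"
    using J(1,2) supp by (intro sum.mono_neutral_left) auto
  finally show ?thesis
    by (simp add: case_prod_beta)
qed

text \<open>The two truncated weights recombine through
  \<open>max 0 k - max 0 (- k) = k\<close>.\<close>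

lemma signed_integral_associated_measure:
  assumes "fst ` A \<subseteq> Rp p" "f \<in> borel_measurable (Rp_borel p)"
    and "finite J" "J \<subseteq> A" "\<And>x k. (x, k) \<in> A - J \<Longrightarrow> f x = 0"
  shows "signed_integral (associated_measure p A) f = (\<Sum>(x, k)\<in>J. real_of_int k * f x)"
proof -
  have "signed_integral (associated_measure p A) f =
          (\<Sum>(x, k)\<in>J. max 0 (real_of_int k) * f x) -
          (\<Sum>(x, k)\<in>J. max 0 (real_of_int (- k)) * f x)"
    by (simp only: signed_integral_def associated_measure_def fst_conv snd_conv
        integral_weighted_point_masses[OF assms])
  also have "\<dots> = (\<Sum>(x, k)\<in>J. real_of_int k * f x)"
    unfolding sum_subtractf[symmetric] by (rule sum.cong) (auto simp: max_def)
  finally show ?thesis .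
qed


subsection \<open>Perturbations of the integers without zero\<close>

text \<open>One family covers both parts of the example: perturbations by the dipole lengths with
  multiplicity 1, and unperturbed integers with multiplicity -1. Omitting the index 0 creates the
  hole at the origin.\<close>

definition perturbed_integers :: "(int \<Rightarrow> real) \<Rightarrow> int \<Rightarrow> multiple_set" where
  "perturbed_integers d c = (\<lambda>n. (line_point (of_int n + d n), c)) ` (- {0})"

lemma perturbed_integers_subset: "fst ` perturbed_integers d c \<subseteq> Rp 1"
  using line_point_in by (auto simp: perturbed_integers_def)

lemma inj_perturbation:
  assumes "\<And>n. 0 \<le> d n \<and> d n \<le> 1/32"
  shows "inj (\<lambda>n::int. real_of_int n + d n)"
proof (rule injI)
  fix m n :: int
  assume "real_of_int m + d m = real_of_int n + d n"
  then have "\<bar>real_of_int m - real_of_int n\<bar> < 1"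
    using assms[of m] assms[of n] by linarith
  then show "m = n"
    by linarith
qed

lemma signed_integral_perturbed_integers:
  assumes d: "\<And>n. 0 \<le> d n \<and> d n \<le> 1/32"
    and \<phi>: "continuous_map (Euclidean_space 1) euclideanreal \<phi>"
    and K: "finite K" "K \<subseteq> - {0}"
      "\<And>n. n \<noteq> 0 \<Longrightarrow> n \<notin> K \<Longrightarrow> \<phi> (line_point (r + of_int n + d n)) = 0"
  shows "signed_integral (associated_measure 1 (perturbed_integers d c))
             (\<lambda>t. \<phi> (line_point r + t)) =
           of_int c * (\<Sum>n\<in>K. \<phi> (line_point (r + of_int n + d n)))"
proof -
  let ?P = "\<lambda>n::int. (line_point (of_int n + d n), c)"
  have inj: "inj_on ?P K"
    using inj_perturbation[of d, OF d] by (auto simp: inj_on_def)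
  have "signed_integral (associated_measure 1 (perturbed_integers d c))
          (\<lambda>t. \<phi> (line_point r + t)) =
        (\<Sum>(x, k)\<in>?P ` K. real_of_int k * \<phi> (line_point r + x))"
  proof (rule signed_integral_associated_measure)
    show "(\<lambda>t. \<phi> (line_point r + t)) \<in> borel_measurable (Rp_borel 1)"
      by (intro continuous_map_borel_measurable continuous_map_translate \<phi>)
    show "\<phi> (line_point r + x) = 0" if "(x, k) \<in> perturbed_integers d c - ?P ` K" for x k
    proof -
      from that obtain n where "n \<noteq> 0" "n \<notin> K" "x = line_point (of_int n + d n)"
        by (auto simp: perturbed_integers_def)
      with K(3)[of n] show ?thesis
        by (simp add: line_point_add add.assoc)
    qed
  qed (use K perturbed_integers_subset in \<open>auto simp: perturbed_integers_def\<close>)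
  also have "\<dots> = of_int c * (\<Sum>n\<in>K. \<phi> (line_point (r + of_int n + d n)))"
    by (simp add: sum.reindex[OF inj] sum_distrib_left line_point_add add.assoc)
  finally show ?thesis .
qed

section \<open>A test function that sees at most one perturbed integer at a time\<close>

definition tent :: "(nat \<Rightarrow> real) \<Rightarrow> real" where
  "tent x = max 0 (1 - 4 * \<bar>x 0\<bar>)"

lemma tent_line_point: "tent (line_point r) = max 0 (1 - 4 * \<bar>r\<bar>)"
  by (simp add: tent_def)

lemma continuous_compact_support_tent: "continuous_compact_support 1 tent"
proof -
  let ?I = "line_point ` {-1/4..1/4}"
  have cont: "continuous_map (Euclidean_space 1) euclideanreal tent"
    unfolding continuous_map_line_iff tent_line_point by (intro continuous_intros)
  have comp: "compactin (Euclidean_space 1) ?I"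
    by (rule image_compactin[OF _ continuous_map_line_point]) simp
  have "x \<in> ?I" if "x \<in> Rp 1" "tent x \<noteq> 0" for x
  proof (rule image_eqI[of _ _ "x 0"])
    have "\<not> \<bar>x 0\<bar> \<ge> 1/4"
      using that(2) by (auto simp: tent_def)
    then show "x 0 \<in> {-1/4..1/4}"
      by auto
  qed (rule line_point_of[OF that(1), symmetric])
  then have "{x \<in> Rp 1. tent x \<noteq> 0} \<subseteq> ?I"
    by blast
  \<comment> \<open>Closedness makes \<open>?I\<close> contain the closure of the support as well,
    which is then a closed subset of a compact set.\<close>
  moreover have "closedin (Euclidean_space 1) ?I"
    unfolding closedin_Euclidean_space_iff
  proof
    have "continuous_on UNIV (\<lambda>r. line_point r i)" for i
      by (cases "i = 0") (simp_all add: line_point_def)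
    then have "continuous_on UNIV line_point"
      by (rule continuous_on_coordinatewise_then_product)
    then show "closed ?I"
      by (intro compact_imp_closed compact_continuous_image)
        (auto intro: continuous_on_subset)
    show "?I \<subseteq> Rp 1"
      using line_point_in by blast
  qed
  ultimately have "Euclidean_space 1 closure_of {x \<in> Rp 1. tent x \<noteq> 0} \<subseteq> ?I"
    by (rule closure_of_minimal)
  then have "compactin (Euclidean_space 1) (Euclidean_space 1 closure_of {x \<in> Rp 1. tent x \<noteq> 0})"
    by (rule closed_compactin[OF comp]) (rule closedin_closure_of)
  with cont show ?thesis
    by (simp add: continuous_compact_support_def del: One_nat_def)
qed

text \<open>For \<open>m \<noteq> n\<close> the point of index \<open>m\<close> is at distance at
  least 1 - 1/2 - 1/32 > 1/4 from \<open>- r\<close>, outside the support of the translated tent.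
  Only the index \<open>n\<close> remains, and for \<open>n = 0\<close> the hole leaves
  nothing.\<close>

lemma signed_integral_tent:
  assumes d: "\<And>n. 0 \<le> d n \<and> d n \<le> 1/32" and n: "\<bar>r + of_int n\<bar> \<le> 1/2"
  shows "signed_integral (associated_measure 1 (perturbed_integers d c))
             (\<lambda>t. tent (line_point r + t)) =
           (if n = 0 then 0 else of_int c * max 0 (1 - 4 * \<bar>r + of_int n + d n\<bar>))"
proof -
  have "tent (line_point (r + of_int m + d m)) = 0" if "m \<noteq> n" for m
  proof -
    have "\<bar>real_of_int m - real_of_int n\<bar> \<ge> 1"
      using that by linarith
    then have "\<bar>r + of_int m + d m\<bar> \<ge> 1/4"
      using n d[of m] by linarith
    then show ?thesis
      by (simp add: tent_line_point)
  qed
  then have "signed_integral (associated_measure 1 (perturbed_integers d c))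
      (\<lambda>t. tent (line_point r + t)) =
    of_int c * (\<Sum>m\<in>{n} - {0}. tent (line_point (r + of_int m + d m)))"
    using continuous_compact_support_tent
    by (intro signed_integral_perturbed_integers d) (auto simp: continuous_compact_support_def)
  then show ?thesis
    by (auto simp: tent_line_point insert_Diff_if)
qed

section \<open>The hole at 0 excludes large almost periods\<close>

lemma almost_periodic_fun_large_period:
  assumes "almost_periodic_fun 1 f" "\<epsilon> > 0"
  obtains t where "t > L" "\<And>r. \<bar>f (line_point (r + t)) - f (line_point r)\<bar> < \<epsilon>"
proof -
  let ?T = "{\<tau> \<in> Rp 1. (SUP x\<in>Rp 1. ereal \<bar>f (x + \<tau>) - f x\<bar>) < ereal \<epsilon>}"
  have "relatively_dense 1 ?T"
    using assms unfolding almost_periodic_fun_def by blast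
  then obtain R where R: "\<And>c. c \<in> Rp 1 \<Longrightarrow> ?T \<inter> Rp_ball 1 c R \<noteq> {}"
    unfolding relatively_dense_def by blast
  \<comment> \<open>The centre \<open>L + R\<close> makes the whole ball lie to the right of
    \<open>L\<close>.\<close>
  have "?T \<inter> Rp_ball 1 (line_point (L + R)) R \<noteq> {}"
    by (rule R) (rule line_point_in)
  then obtain \<tau> where \<tau>: "\<tau> \<in> ?T" "\<tau> \<in> Rp_ball 1 (line_point (L + R)) R"
    by blast
  obtain t where t: "\<tau> = line_point t"
    using \<tau>(1) by (auto simp: Rp_1_eq simp del: One_nat_def)
  have "t > L"
    using \<tau>(2) unfolding t line_point_in_ball by linarith
  moreover have "\<bar>f (line_point (r + t)) - f (line_point r)\<bar> < \<epsilon>" for r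
  proof -
    have "ereal \<bar>f (line_point r + \<tau>) - f (line_point r)\<bar> \<le>
            (SUP x\<in>Rp 1. ereal \<bar>f (x + \<tau>) - f x\<bar>)"
      by (rule SUP_upper) (rule line_point_in)
    also have "\<dots> < ereal \<epsilon>"
      using \<tau>(1) by simp
    finally show ?thesis
      by (simp add: t line_point_add)
  qed
  ultimately show thesis
    by (rule that)
qed

text \<open>The function \<open>f\<close> vanishes at 0 because of the hole, but has modulus 1 where
  the tent is centred at the point of index 1. An almost period \<open>t > 2\<close> carries this
  peak near another point of the set, so \<open>t\<close> is close to a nonzero integer. Then
  \<open>f\<close> is large at \<open>- t\<close>, although translation by \<open>t\<close> takes
  \<open>- t\<close> to 0.\<close>

lemma perturbed_integers_not_almost_periodic:
  assumes d: "\<And>n. 0 \<le> d n \<and> d n \<le> 1/32" and c: "\<bar>c\<bar> = 1"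
  shows "\<not> almost_periodic_set 1 (perturbed_integers d c)"
proof
  assume ap: "almost_periodic_set 1 (perturbed_integers d c)"
  define f where "f = (\<lambda>x. signed_integral (associated_measure 1 (perturbed_integers d c))
                              (\<lambda>t. tent (x + t)))"
  have f: "f (line_point r) =
      (if n = 0 then 0 else of_int c * max 0 (1 - 4 * \<bar>r + of_int n + d n\<bar>))"
    if "\<bar>r + of_int n\<bar> \<le> 1/2" for r n
    unfolding f_def using d that by (rule signed_integral_tent)
  have c': "\<bar>real_of_int c\<bar> = 1"
    using c by linarith
  have "almost_periodic_fun 1 f"
    using ap continuous_compact_support_tent
    unfolding almost_periodic_set_def almost_periodic_measure_def f_def by blast
  then obtain t where t: "t > 2" and per: "\<And>r. \<bar>f (line_point (r + t)) - f (line_point r)\<bar> < 1/4"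
    by (rule almost_periodic_fun_large_period[where \<epsilon> = "1/4" and L = 2]) auto
  \<comment> \<open>This argument puts the point of index 1 at the peak of the tent.\<close>
  have "f (line_point (-1 - d 1)) = of_int c"
    using f[of "-1 - d 1" 1] d[of 1] by simp
  then have large: "\<bar>f (line_point (-1 - d 1 + t))\<bar> > 3/4"
    using per[of "-1 - d 1"] c' by linarith
  define n where "n = round (1 + d 1 - t)"
  have "\<bar>-1 - d 1 + t + of_int n\<bar> \<le> 1/2"
    using of_int_round_abs_le[of "1 + d 1 - t"] unfolding n_def by linarith
  \<comment> \<open>A tent value \<open>1 - 4 * u\<close> above 3/4 forces
    \<open>u < 1/16\<close>.\<close>
  with large have "\<bar>-1 - d 1 + t + of_int n + d n\<bar> < 1/16"
    using f[of "-1 - d 1 + t" n] c' by (auto simp: abs_mult max_def split: if_splits)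
  \<comment> \<open>The perturbations \<open>d n\<close> and \<open>d 1\<close> differ by at most
    1/32, and 1/16 + 1/32 = 3/32.\<close>
  then have near: "\<bar>- t + of_int (1 - n)\<bar> < 3/32"
    using d[of n] d[of 1] unfolding of_int_diff of_int_1 by linarith
  with t have "1 - n \<noteq> 0"
    by linarith
  moreover have "\<bar>- t + of_int (1 - n) + d (1 - n)\<bar> < 1/8"
    using near d[of "1 - n"] by linarith
  ultimately have "\<bar>f (line_point (- t))\<bar> > 1/2"
    using f[of "- t" "1 - n"] near c' by (auto simp: abs_mult)
  moreover have "f (line_point 0) = 0"
    using f[of 0 0] by simp
  ultimately show False
    using per[of "- t"] by simp
qed


subsection \<open>Sums of a test function over perturbed integers\<close>

text \<open>The rounding of both end points costs at most 2, and counting both of them adds 1. What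
  matters is that the cardinality bound is uniform in \<open>r\<close>.\<close>

lemma finite_int_near: "finite {n::int. \<bar>r + of_int n\<bar> \<le> C}"
  and card_int_near: "C \<ge> 0 \<Longrightarrow> real (card {n::int. \<bar>r + of_int n\<bar> \<le> C}) \<le> 2 * C + 3"
proof -
  have sub: "{n::int. \<bar>r + of_int n\<bar> \<le> C} \<subseteq> {\<lfloor>- r - C\<rfloor>..\<lceil>C - r\<rceil>}"
    by (auto simp: floor_le_iff le_ceiling_iff)
  then show "finite {n::int. \<bar>r + of_int n\<bar> \<le> C}"
    by (rule finite_subset) simp
  assume "C \<ge> 0"
  have "card {n::int. \<bar>r + of_int n\<bar> \<le> C} \<le> nat (\<lceil>C - r\<rceil> - \<lfloor>- r - C\<rfloor> + 1)"
    using card_mono[OF _ sub] by simp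
  then show "real (card {n::int. \<bar>r + of_int n\<bar> \<le> C}) \<le> 2 * C + 3"
    using \<open>C \<ge> 0\<close> by linarith
qed

section \<open>Uniform estimates for a compactly supported continuous function on the line\<close>

locale line_test_function =
  fixes \<psi> :: "real \<Rightarrow> real" and B :: real
  assumes cont: "continuous_on UNIV \<psi>"
    and nonneg: "B \<ge> 0"
    and support: "\<And>r. \<bar>r\<bar> > B \<Longrightarrow> \<psi> r = 0"
begin

lemma uniform:
  assumes "\<epsilon> > 0"
  obtains \<delta> where "\<delta> > 0" "\<And>u v. \<bar>u - v\<bar> < \<delta> \<Longrightarrow> \<bar>\<psi> u - \<psi> v\<bar> < \<epsilon>"
proof -
  have "uniformly_continuous_on {-B-1..B+1} \<psi>"
    by (rule compact_uniformly_continuous) (auto intro: continuous_on_subset[OF cont])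
  then obtain \<delta> where \<delta>: "\<delta> > 0"
    "\<And>u v. u \<in> {-B-1..B+1} \<Longrightarrow> v \<in> {-B-1..B+1} \<Longrightarrow> \<bar>u - v\<bar> < \<delta> \<Longrightarrow> \<bar>\<psi> u - \<psi> v\<bar> < \<epsilon>"
    using assms unfolding uniformly_continuous_on_def dist_real_def by metis
  \<comment> \<open>Either both points lie outside the support, or one is in \<open>{-B..B}\<close>
    and the other at distance below 1, so that both are in the enlarged compact interval.\<close>
  have "\<bar>\<psi> u - \<psi> v\<bar> < \<epsilon>" if uv: "\<bar>u - v\<bar> < min \<delta> 1" for u v
  proof (cases "\<bar>u\<bar> > B \<and> \<bar>v\<bar> > B")
    case True
    then show ?thesis
      using support assms by simp
  next
    case False
    with uv show ?thesis
      by (intro \<delta>(2)) auto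
  qed
  with \<delta>(1) show thesis
    by (intro that[of "min \<delta> 1"]) auto
qed

lemma support_near:
  assumes "\<And>n. \<bar>a n - (r + of_int n)\<bar> \<le> 1"
  shows "{n. \<psi> (a n) \<noteq> 0} \<subseteq> {n::int. \<bar>r + of_int n\<bar> \<le> B + 1}"
proof
  fix n
  assume "n \<in> {n. \<psi> (a n) \<noteq> 0}"
  then have "\<not> \<bar>a n\<bar> > B"
    using support by blast
  with assms[of n] show "n \<in> {n. \<bar>r + of_int n\<bar> \<le> B + 1}"
    by auto
qed

text \<open>At most \<open>C\<close> terms are nonzero, wherever the window lies, and uniform
  continuity makes each difference small. As \<open>\<delta>\<close> depends on none of
  \<open>r\<close>, \<open>a\<close>, \<open>b\<close>, this one estimate yields both continuity and
  almost periods.\<close>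

lemma Sum_any_close:
  assumes "\<epsilon> > 0"
  obtains \<delta> where "\<delta> > 0"
    "\<And>r a b. (\<And>n::int. \<bar>a n - (r + of_int n)\<bar> \<le> 1) \<Longrightarrow> (\<And>n. \<bar>b n - (r + of_int n)\<bar> \<le> 1) \<Longrightarrow>
       (\<And>n. \<bar>a n - b n\<bar> < \<delta>) \<Longrightarrow>
       \<bar>Sum_any (\<lambda>n. \<psi> (a n)) - Sum_any (\<lambda>n. \<psi> (b n))\<bar> < \<epsilon>"
proof -
  \<comment> \<open>This is the bound of \<open>card_int_near\<close> for the window radius
    \<open>B + 1\<close> of \<open>support_near\<close>.\<close>
  define C where "C = 2 * (B + 1) + 3"
  have C: "C > 0"
    using nonneg by (simp add: C_def)
  obtain \<delta> where \<delta>: "\<delta> > 0" "\<And>u v. \<bar>u - v\<bar> < \<delta> \<Longrightarrow> \<bar>\<psi> u - \<psi> v\<bar> < \<epsilon> / (2 * C)"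
    using uniform[of "\<epsilon> / (2 * C)"] assms C by auto
  have "\<bar>Sum_any (\<lambda>n. \<psi> (a n)) - Sum_any (\<lambda>n. \<psi> (b n))\<bar> < \<epsilon>"
    if a: "\<And>n::int. \<bar>a n - (r + of_int n)\<bar> \<le> 1" and b: "\<And>n. \<bar>b n - (r + of_int n)\<bar> \<le> 1"
      and ab: "\<And>n. \<bar>a n - b n\<bar> < \<delta>" for r a b
  proof -
    let ?J = "{n::int. \<bar>r + of_int n\<bar> \<le> B + 1}"
    have "\<bar>Sum_any (\<lambda>n. \<psi> (a n)) - Sum_any (\<lambda>n. \<psi> (b n))\<bar> =
            \<bar>\<Sum>n\<in>?J. \<psi> (a n) - \<psi> (b n)\<bar>"
      by (simp only: Sum_any.expand_superset[OF finite_int_near support_near[of a, OF a]]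
          Sum_any.expand_superset[OF finite_int_near support_near[of b, OF b]] sum_subtractf)
    also have "\<dots> \<le> (\<Sum>n\<in>?J. \<bar>\<psi> (a n) - \<psi> (b n)\<bar>)"
      by (rule sum_abs)
    also have "\<dots> \<le> real (card ?J) * (\<epsilon> / (2 * C))"
      using \<delta>(2)[OF ab] by (intro sum_bounded_above) (simp add: less_imp_le)
    also have "\<dots> \<le> C * (\<epsilon> / (2 * C))"
      using card_int_near[of "B + 1" r] nonneg assms C
      by (intro mult_right_mono) (auto simp: C_def)
    also have "\<dots> < \<epsilon>"
      using C assms by simp
    finally show ?thesis .
  qed
  with \<delta>(1) show thesis
    by (rule that)
qed

text \<open>The index 0 is included, unlike in \<open>perturbed_integers\<close>, so that integer
  translations act by reindexing over all integers.\<close>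

definition translate_sum :: "(int \<Rightarrow> real) \<Rightarrow> real \<Rightarrow> real" where
  "translate_sum d r = Sum_any (\<lambda>n. \<psi> (r + of_int n + d n))"

lemma translate_sum_expand:
  assumes "\<And>n. \<bar>d n\<bar> \<le> 1" "finite K" "{n. \<bar>r + of_int n\<bar> \<le> B + 1} \<subseteq> K"
  shows "translate_sum d r = (\<Sum>n\<in>K. \<psi> (r + of_int n + d n))"
proof -
  have "{n. \<psi> (r + of_int n + d n) \<noteq> 0} \<subseteq> {n. \<bar>r + of_int n\<bar> \<le> B + 1}"
    by (rule support_near) (simp add: assms(1))
  with assms(2,3) show ?thesis
    unfolding translate_sum_def by (intro Sum_any.expand_superset) auto
qed

lemma continuous_translate_sum:
  assumes d: "\<And>n. \<bar>d n\<bar> \<le> 1/2"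
  shows "continuous_on UNIV (translate_sum d)"
  unfolding continuous_on_iff dist_real_def
proof (intro ballI allI impI)
  fix r \<epsilon> :: real
  assume "\<epsilon> > 0"
  then obtain \<delta> where \<delta>: "\<delta> > 0"
    "\<And>r a b. (\<And>n::int. \<bar>a n - (r + of_int n)\<bar> \<le> 1) \<Longrightarrow> (\<And>n. \<bar>b n - (r + of_int n)\<bar> \<le> 1) \<Longrightarrow>
       (\<And>n. \<bar>a n - b n\<bar> < \<delta>) \<Longrightarrow>
       \<bar>Sum_any (\<lambda>n. \<psi> (a n)) - Sum_any (\<lambda>n. \<psi> (b n))\<bar> < \<epsilon>"
    using Sum_any_close by metis
  \<comment> \<open>The perturbation uses 1/2 of the allowed distance 1 from
    \<open>r + of_int n\<close>, and the move from \<open>r\<close> to \<open>s\<close> uses less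
    than the other 1/2.\<close>
  have "\<bar>translate_sum d s - translate_sum d r\<bar> < \<epsilon>" if "\<bar>s - r\<bar> < min \<delta> (1/2)" for s
  proof -
    have "\<bar>s + of_int n + d n - (r + of_int n)\<bar> \<le> 1" "\<bar>r + of_int n + d n - (r + of_int n)\<bar> \<le> 1"
      for n
      using d[of n] that by linarith+
    with that show ?thesis
      unfolding translate_sum_def by (intro \<delta>(2)[where r = r]) auto
  qed
  with \<delta>(1) show "\<exists>\<delta>>0. \<forall>s\<in>UNIV. \<bar>s - r\<bar> < \<delta> \<longrightarrow> \<bar>translate_sum d s - translate_sum d r\<bar> < \<epsilon>"
    by (intro exI[of _ "min \<delta> (1/2)"]) auto
qed

text \<open>An integer translation of the argument becomes a shift of the perturbation sequence,
  which reduces almost periods of the sum to almost periods of \<open>d\<close>.\<close>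

lemma translate_sum_shift:
  "translate_sum d (r + of_int k) = Sum_any (\<lambda>n. \<psi> (r + of_int n + d (n - k)))"
  unfolding translate_sum_def
proof (rule Sum_any.reindex_cong[symmetric, of "\<lambda>n. n + k"])
  show "bij (\<lambda>n. n + k)"
    by (rule bij_plus_right)
qed (simp add: fun_eq_iff algebra_simps)

end


subsection \<open>Dipoles of 2-adically decreasing length\<close>

text \<open>The value 0 at \<open>n = 0\<close> is the limit for valuation tending to infinity. It
  is set separately because \<open>multiplicity 2 0\<close> is 0 by convention.\<close>

definition dipole_length :: "int \<Rightarrow> real" where
  "dipole_length n = (if n = 0 then 0 else 1 / (32 * (1 + real (multiplicity 2 n))))"

definition dipoles :: multiple_set where
  "dipoles = perturbed_integers dipole_length 1 \<union> perturbed_integers (\<lambda>_. 0) (-1)"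

lemma dipole_length_bounds: "0 \<le> dipole_length n \<and> dipole_length n \<le> 1/32"
  by (auto simp: dipole_length_def field_simps)

lemma dipole_length_pos: "n \<noteq> 0 \<Longrightarrow> dipole_length n > 0"
  by (auto simp: dipole_length_def intro!: divide_pos_pos add_pos_nonneg)

lemma dipole_length_small:
  assumes "2 ^ K dvd n"
  shows "dipole_length n \<le> 1 / (32 * (1 + real K))"
proof (cases "n = 0")
  case False
  then have "K \<le> multiplicity 2 n"
    using assms by (intro multiplicity_geI) auto
  with False show ?thesis
    by (auto simp: dipole_length_def intro!: divide_left_mono)
qed (simp add: dipole_length_def)

text \<open>If \<open>2 ^ K\<close> divides \<open>n\<close>, both lengths lie between 0 and the
  bound. Otherwise the ultrametric property gives \<open>n\<close> and \<open>n - m\<close> the same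
  valuation, and the lengths coincide.\<close>

lemma dipole_length_almost_period:
  assumes "2 ^ K dvd m"
  shows "\<bar>dipole_length (n - m) - dipole_length n\<bar> \<le> 1 / (32 * (1 + real K))"
proof (cases "2 ^ K dvd n")
  case True
  then have "2 ^ K dvd n - m"
    using assms by simp
  with True show ?thesis
    using dipole_length_small[of K n] dipole_length_small[of K "n - m"]
      dipole_length_bounds[of n] dipole_length_bounds[of "n - m"] by linarith
next
  case False
  then have nz: "n \<noteq> 0" "n - m \<noteq> 0"
    using assms by auto
  have "multiplicity 2 (n - m) = multiplicity 2 n" if "m \<noteq> 0"
  proof -
    have "2 ^ K dvd - m"
      using assms by simp
    then have "K \<le> multiplicity 2 (- m)"
      using that by (intro multiplicity_geI) auto
    moreover have "multiplicity 2 n < K"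
      using False by (metis not_le multiplicity_dvd')
    ultimately show ?thesis
      using multiplicity_sum_lt[of 2 n "- m"] nz that by simp
  qed
  with nz have "dipole_length (n - m) = dipole_length n"
    by (cases "m = 0") (auto simp: dipole_length_def)
  then show ?thesis
    by simp
qed

section \<open>Discreteness of the dipole configuration\<close>

lemma dipoles_cases:
  assumes "(x, k) \<in> dipoles"
  obtains (positive) n where "n \<noteq> 0" "k = 1" "x = line_point (of_int n + dipole_length n)"
    | (negative) n where "n \<noteq> 0" "k = - 1" "x = line_point (of_int n)"
proof -
  from assms consider "(x, k) \<in> perturbed_integers dipole_length 1"
    | "(x, k) \<in> perturbed_integers (\<lambda>_. 0) (-1)"
    unfolding dipoles_def by blast
  then show thesis
  proof cases
    case 1
    then show thesis
      unfolding perturbed_integers_def by (elim imageE) (rule positive, simp_all)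
  next
    case 2
    then show thesis
      unfolding perturbed_integers_def by (elim imageE) (rule negative, simp_all)
  qed
qed

lemma signed_multiple_discrete_set_dipoles: "signed_multiple_discrete_set 1 dipoles"
  unfolding signed_multiple_discrete_set_def
proof (intro conjI ballI allI)
  \<comment> \<open>No positive point meets a negative one, for the integer \<open>n - m\<close>
    would lie strictly between 0 and 1. Multiplicities are therefore unambiguous.\<close>
  have apart: False if "m \<noteq> 0" "real_of_int m + dipole_length m = of_int n" for m n
  proof -
    have "0 < real_of_int (n - m)" "real_of_int (n - m) < 1"
      using dipole_length_pos[OF that(1)] dipole_length_bounds[of m] that(2) by auto
    then have "0 < n - m" "n - m < 1"
      by (simp_all only: of_int_0_less_iff of_int_less_1_iff)
    then show False
      by linarith
  qed
  show "single_valued dipoles"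
  proof (rule single_valuedI)
    show "k = l" if "(x, k) \<in> dipoles" "(x, l) \<in> dipoles" for x k l
      using that(1)
    proof (cases rule: dipoles_cases)
      case (positive m)
      show ?thesis
        using that(2)
      proof (cases rule: dipoles_cases)
        case (negative n)
        with positive(3) show ?thesis
          using apart[OF positive(1), of n] by simp
      qed (simp add: positive(2))
    next
      case (negative m)
      show ?thesis
        using that(2)
      proof (cases rule: dipoles_cases)
        case (positive n)
        with negative(3) show ?thesis
          using apart[OF positive(1), of m] by simp
      qed (simp add: negative(2))
    qed
  qed
  show "fst ` dipoles \<subseteq> Rp 1"
    using perturbed_integers_subset by (simp add: dipoles_def image_Un del: One_nat_def)
  show "case z of (x, k) \<Rightarrow> k \<noteq> 0" if "z \<in> dipoles" for z
    using that by (auto simp: dipoles_def perturbed_integers_def)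
  have fin: "finite (fst ` perturbed_integers d c \<inter> Rp_ball 1 (line_point s) R)"
    if d: "\<And>n. \<bar>d n\<bar> \<le> 1" for d c s R
  proof (rule finite_subset)
    show "fst ` perturbed_integers d c \<inter> Rp_ball 1 (line_point s) R \<subseteq>
            (\<lambda>n. line_point (of_int n + d n)) ` {n. \<bar>- s + of_int n\<bar> \<le> R + 1}"
    proof
      fix x
      assume x: "x \<in> fst ` perturbed_integers d c \<inter> Rp_ball 1 (line_point s) R"
      then have "x \<in> (\<lambda>n. line_point (of_int n + d n)) ` (- {0})"
        by (simp add: perturbed_integers_def image_image)
      then obtain n where n: "x = line_point (of_int n + d n)"
        by (rule imageE)
      with x have "\<bar>of_int n + d n - s\<bar> < R"
        by (simp only: line_point_in_ball Int_iff)
      then have "\<bar>- s + of_int n\<bar> \<le> R + 1"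
        using d[of n] by linarith
      with n(1) show "x \<in> (\<lambda>n. line_point (of_int n + d n)) ` {n. \<bar>- s + of_int n\<bar> \<le> R + 1}"
        by blast
    qed
  qed (rule finite_imageI[OF finite_int_near])
  show "finite (fst ` dipoles \<inter> Rp_ball 1 x R)" if "x \<in> Rp 1" for x R
  proof -
    obtain s where "x = line_point s"
      using \<open>x \<in> Rp 1\<close> unfolding Rp_1_eq by blast
    moreover have "\<bar>dipole_length n\<bar> \<le> 1" for n
      using dipole_length_bounds[of n] by linarith
    ultimately show ?thesis
      using fin[of dipole_length 1 s R] fin[of "\<lambda>_. 0" "-1" s R]
      by (simp add: dipoles_def image_Un Int_Un_distrib2 del: One_nat_def)
  qed
qed

section \<open>Almost periodicity of the dipole configuration\<close>

lemma signed_integral_dipoles: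
  assumes \<phi>: "continuous_map (Euclidean_space 1) euclideanreal \<phi>"
    and "line_test_function (\<lambda>r. \<phi> (line_point r)) B"
  shows "signed_integral (associated_measure 1 dipoles) (\<lambda>t. \<phi> (line_point r + t)) =
           line_test_function.translate_sum (\<lambda>r. \<phi> (line_point r)) dipole_length r -
           line_test_function.translate_sum (\<lambda>r. \<phi> (line_point r)) (\<lambda>_. 0) r"
proof -
  interpret line_test_function "\<lambda>r. \<phi> (line_point r)" B
    by fact
  let ?J = "{n::int. \<bar>r + of_int n\<bar> \<le> B + 1}"
  let ?P = "\<lambda>n::int. (line_point (of_int n + dipole_length n), 1::int)"
  let ?N = "\<lambda>n::int. (line_point (of_int n), -1::int)"
  have bound: "\<bar>dipole_length n\<bar> \<le> 1" for n
    using dipole_length_bounds[of n] by linarith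
  have zero: "\<phi> (line_point (r + (of_int n + d n))) = 0" if "n \<notin> ?J" "\<bar>d n\<bar> \<le> 1" for n d
    using that by (intro support) auto
  have inj: "inj_on ?P (?J - {0})" "inj_on ?N (?J - {0})"
    using inj_perturbation[OF dipole_length_bounds] by (auto simp: inj_on_def)
  have "signed_integral (associated_measure 1 dipoles) (\<lambda>t. \<phi> (line_point r + t)) =
          (\<Sum>(x, k)\<in>?P ` (?J - {0}) \<union> ?N ` (?J - {0}). real_of_int k * \<phi> (line_point r + x))"
  proof (rule signed_integral_associated_measure)
    show "fst ` dipoles \<subseteq> Rp 1"
      using signed_multiple_discrete_set_dipoles by (simp add: signed_multiple_discrete_set_def)
    show "\<phi> (line_point r + x) = 0"
      if "(x, k) \<in> dipoles - (?P ` (?J - {0}) \<union> ?N ` (?J - {0}))" for x k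
    proof -
      from that have "(x, k) \<in> dipoles"
        by (rule DiffD1)
      then show ?thesis
      proof (cases rule: dipoles_cases)
        case (positive n)
        with that have "n \<notin> ?J"
          by blast
        from zero[of n dipole_length, OF this bound] positive(3) show ?thesis
          by (simp add: line_point_add)
      next
        case (negative n)
        with that have "n \<notin> ?J"
          by blast
        from zero[of n "\<lambda>_. 0", OF this] negative(3) show ?thesis
          by (simp add: line_point_add)
      qed
    qed
    show "(\<lambda>t. \<phi> (line_point r + t)) \<in> borel_measurable (Rp_borel 1)"
      by (intro continuous_map_borel_measurable continuous_map_translate \<phi>)
  qed (auto simp: dipoles_def perturbed_integers_def finite_int_near)
  also have "\<dots> = (\<Sum>(x, k)\<in>?P ` (?J - {0}). real_of_int k * \<phi> (line_point r + x)) +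
      (\<Sum>(x, k)\<in>?N ` (?J - {0}). real_of_int k * \<phi> (line_point r + x))"
    by (rule sum.union_disjoint) (auto simp: finite_int_near)
  also have "\<dots> = (\<Sum>n\<in>?J - {0}. \<phi> (line_point (r + of_int n + dipole_length n))) -
      (\<Sum>n\<in>?J - {0}. \<phi> (line_point (r + of_int n + 0)))"
    by (simp add: sum.reindex[OF inj(1)] sum.reindex[OF inj(2)] line_point_add add.assoc sum_negf)
  \<comment> \<open>The index 0 can be restored: since \<open>dipole_length 0 = 0\<close>, its two
    terms cancel, although neither alone need vanish. This cancellation fills the hole.\<close>
  also have "\<dots> = (\<Sum>n\<in>?J. \<phi> (line_point (r + of_int n + dipole_length n))) -
      (\<Sum>n\<in>?J. \<phi> (line_point (r + of_int n + 0)))"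
    unfolding sum_subtractf[symmetric]
    by (rule sum.mono_neutral_left) (auto simp: finite_int_near dipole_length_def)
  also have "\<dots> = translate_sum dipole_length r - translate_sum (\<lambda>_. 0) r"
    by (simp add: translate_sum_expand[OF _ finite_int_near order_refl] bound)
  finally show ?thesis .
qed

lemma almost_periodic_set_dipoles: "almost_periodic_set 1 dipoles"
  unfolding almost_periodic_set_def almost_periodic_measure_def
proof (intro conjI allI impI)
  show "locally_finite_signed_measure 1 (associated_measure 1 dipoles)"
    by (rule locally_finite_associated_measure[OF signed_multiple_discrete_set_dipoles])
  fix \<phi>
  assume \<phi>: "continuous_compact_support 1 \<phi>"
  then have \<phi>_cont: "continuous_map (Euclidean_space 1) euclideanreal \<phi>"
    by (simp add: continuous_compact_support_def)
  obtain B where B: "B \<ge> 0" "\<And>r. \<bar>r\<bar> > B \<Longrightarrow> \<phi> (line_point r) = 0"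
    using continuous_compact_support_line[OF \<phi>] by blast
  interpret line_test_function "\<lambda>r. \<phi> (line_point r)" B
    using \<phi>_cont B by unfold_locales (auto simp: continuous_map_line_iff simp del: One_nat_def)
  define f where "f = (\<lambda>x. signed_integral (associated_measure 1 dipoles) (\<lambda>t. \<phi> (x + t)))"
  have f: "f (line_point r) = translate_sum dipole_length r - translate_sum (\<lambda>_. 0) r" for r
    unfolding f_def by (rule signed_integral_dipoles[OF \<phi>_cont line_test_function_axioms])
  have bound: "\<bar>dipole_length n\<bar> \<le> 1/2" for n
    using dipole_length_bounds[of n] by linarith
  have "almost_periodic_fun 1 f"
    unfolding almost_periodic_fun_def
  proof (intro conjI allI impI)
    show "continuous_map (Euclidean_space 1) euclideanreal f"
      unfolding continuous_map_line_iff f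
      by (intro continuous_on_diff continuous_translate_sum bound) simp
  next
    fix \<epsilon> :: real
    assume "\<epsilon> > 0"
    \<comment> \<open>Strict pointwise bounds give only a non-strict bound on the supremum; half of
      \<open>\<epsilon>\<close> keeps the final inequality strict.\<close>
    then have "\<epsilon> / 2 > 0"
      by simp
    from Sum_any_close[OF this] obtain \<delta> where \<delta>: "\<delta> > 0"
      "\<And>r a b. (\<And>n::int. \<bar>a n - (r + of_int n)\<bar> \<le> 1) \<Longrightarrow> (\<And>n. \<bar>b n - (r + of_int n)\<bar> \<le> 1) \<Longrightarrow>
         (\<And>n. \<bar>a n - b n\<bar> < \<delta>) \<Longrightarrow>
         \<bar>Sum_any (\<lambda>n. \<phi> (line_point (a n))) - Sum_any (\<lambda>n. \<phi> (line_point (b n)))\<bar> < \<epsilon> / 2"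
      by metis
    obtain K where K: "1 / (1 + real K) < \<delta>"
      using \<delta>(1) reals_Archimedean[of \<delta>] by (auto simp: inverse_eq_divide)
    define N :: int where "N = 2 ^ K"
    \<comment> \<open>Every multiple of \<open>N = 2 ^ K\<close> shifts the lengths by less than
      \<open>\<delta>\<close> uniformly in the index, while the unperturbed sum has all integers as
      exact periods.\<close>
    have period: "\<bar>f (line_point (r + of_int (N * j))) - f (line_point r)\<bar> < \<epsilon> / 2" for r j
    proof -
      have "\<bar>dipole_length (n - N * j) - dipole_length n\<bar> < \<delta>" for n
      proof -
        have "\<bar>dipole_length (n - N * j) - dipole_length n\<bar> \<le> 1 / (32 * (1 + real K))"
          by (rule dipole_length_almost_period) (simp add: N_def)
        also have "\<dots> \<le> 1 / (1 + real K)"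
          by (simp add: field_simps)
        finally show ?thesis
          using K by simp
      qed
      moreover have "\<bar>dipole_length n\<bar> \<le> 1" for n
        using bound[of n] by linarith
      ultimately have "\<bar>translate_sum dipole_length (r + of_int (N * j)) - translate_sum dipole_length r\<bar>
          < \<epsilon> / 2"
        unfolding translate_sum_shift
        unfolding translate_sum_def by (intro \<delta>(2)[where r = r]) auto
      moreover have "translate_sum (\<lambda>_. 0) (r + of_int (N * j)) = translate_sum (\<lambda>_. 0) r"
        unfolding translate_sum_shift unfolding translate_sum_def ..
      ultimately show ?thesis
        unfolding f by linarith
    qed
    let ?T = "{\<tau> \<in> Rp 1. (SUP x\<in>Rp 1. ereal \<bar>f (x + \<tau>) - f x\<bar>) < ereal \<epsilon>}"
    have in_T: "line_point (of_int (N * j)) \<in> ?T" for j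
    proof -
      have "(SUP x\<in>Rp 1. ereal \<bar>f (x + line_point (of_int (N * j))) - f x\<bar>) \<le> ereal (\<epsilon> / 2)"
      proof (rule SUP_least)
        fix x
        assume "x \<in> Rp 1"
        then obtain r where "x = line_point r"
          unfolding Rp_1_eq by blast
        then show "ereal \<bar>f (x + line_point (of_int (N * j))) - f x\<bar> \<le> ereal (\<epsilon> / 2)"
          using period[of r j] by (simp add: line_point_add)
      qed
      also have "\<dots> < ereal \<epsilon>"
        using \<open>\<epsilon> > 0\<close> by simp
      finally show ?thesis
        using line_point_in by blast
    qed
    show "relatively_dense 1 ?T"
      unfolding relatively_dense_def
    proof (intro exI ballI)
      fix x
      assume "x \<in> Rp 1"
      then obtain r where x: "x = line_point r"
        unfolding Rp_1_eq by blast
      \<comment> \<open>Then \<open>N * j\<close> is the largest multiple of \<open>N\<close> not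
        exceeding \<open>r\<close>, at distance less than \<open>N\<close>.\<close>
      define j where "j = \<lfloor>r / of_int N\<rfloor>"
      have N: "real_of_int N > 0"
        by (simp add: N_def)
      have "of_int j \<le> r / of_int N" "r / of_int N < of_int j + 1"
        unfolding j_def by linarith+
      with N have "of_int (N * j) \<le> r" "r < of_int (N * j) + of_int N"
        by (simp_all add: field_simps)
      then have "line_point (of_int (N * j)) \<in> Rp_ball 1 x (of_int N + 1)"
        unfolding x line_point_in_ball by linarith
      with in_T[of j] show "?T \<inter> Rp_ball 1 x (of_int N + 1) \<noteq> {}"
        by blast
    qed
  qed
  then show "almost_periodic_fun 1 (\<lambda>x. signed_integral (associated_measure 1 dipoles) (\<lambda>t. \<phi> (x + t)))"
    unfolding f_def .
qed

lemma positive_part_dipoles: "positive_part dipoles = perturbed_integers dipole_length 1"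
  and negative_part_dipoles: "negative_part dipoles = perturbed_integers (\<lambda>_. 0) (-1)"
  by (auto simp: positive_part_def negative_part_def dipoles_def perturbed_integers_def)

theorem theorem6:
  shows "\<exists>p\<ge>1. \<exists>A. signed_multiple_discrete_set p A \<and> almost_periodic_set p A \<and>
           \<not> almost_periodic_set p (positive_part A) \<and>
           \<not> almost_periodic_set p (negative_part A)"
proof (intro exI conjI)
  show "(1::nat) \<le> 1" ..
  show "signed_multiple_discrete_set 1 dipoles"
    by (rule signed_multiple_discrete_set_dipoles)
  show "almost_periodic_set 1 dipoles"
    by (rule almost_periodic_set_dipoles)
  show "\<not> almost_periodic_set 1 (positive_part dipoles)"
    unfolding positive_part_dipoles
    by (rule perturbed_integers_not_almost_periodic[OF dipole_length_bounds]) simp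
  show "\<not> almost_periodic_set 1 (negative_part dipoles)"
    unfolding negative_part_dipoles
    by (rule perturbed_integers_not_almost_periodic) auto
qed

end
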